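(* Let $M^{2n+1}$, $n\ge 1$, be a smooth real manifold of real dimension $2n+1$ with a pseudo-convex CR structure $(H(M),J)$ of hypersurface type. Let $U\subset M$ be an open set on which there are a smooth non-vanishing real $1$-form $\theta$ with $H(U)=\theta^{\perp}$ and real smooth vector fields $X_1,\ldots,X_n$ such that $X_j, JX_j$, $j=1,\ldots,n$, span $H(U)$; put $L_j:=X_j-\sqrt{-1}\,JX_j$, and let $T=[T_{jk}]_{n\times n}$, $T_{jk}:=\mathcal L(L_j,L_k)$, be the matrix representation on $U$ of the Levi-form $\mathcal L$ determined by $\theta$, with $T$ positive semi-definite at every point of $U$. Write the characteristic polynomial of $T$ as $$\det(T-\lambda I)=\sum_{k=0}^{n-1}A_k(-\lambda)^k+(-\lambda)^n,$$ where $A_0,\ldots,A_{n-1}$ are functions on $U$. For $q=1,\ldots,n$ let $\mathcal S_q$ be the set of points of $M$ where the Levi-form has nullity $\ge q$. Then for each $q=1,\ldots,n$, $$\mathcal S_q\cap U=\{x\in U: A_j(x)=0 \text{ for all } j \text{ with } 0\le j\le q-1\}.$$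
   Context: All objects are $C^\infty$; manifolds are assumed connected and oriented. A CR structure of hypersurface type on $M^{2n+1}$ is a pair $(H(M),J)$, where $H(M)$ is a smooth subbundle of codimension $1$ of the tangent bundle $T(M)$ and $J:H(M)\to H(M)$ is a smooth bundle isomorphism over the identity of $M$ with $J^2=-I_{2n}$. Then $\mathbb C\otimes H(M)=H^{1,0}(M)\oplus H^{0,1}(M)$, the eigenbundles of $J$ for the eigenvalues $\sqrt{-1}$ and $-\sqrt{-1}$ respectively. Locally, on an open set $U$, $H(U)=\theta^\perp:=\{V\in T(U):\theta(V)=0\}$ for a smooth non-vanishing real $1$-form $\theta$, and the vector fields $L_j=X_j-\sqrt{-1}JX_j$ span $H^{1,0}(U)$. The Levi-form is the hermitian form on $H^{1,0}(U)$ given by $\mathcal L(L,L'):=\frac{1}{\sqrt{-1}}\,d\theta(L\wedge\bar L')$. The CR structure is pseudo-convex if $\mathcal L$ is semi-definite at every point of $M$. The null space at $x\in M$ is $\mathcal N_x:=\{L\in H^{1,0}_x(M):\mathcal L(L,L)=0\}$, which is a subspace when $M$ is pseudo-convex; its complex dimension is the nullity of the Levi-form at $x$ (independent of the choice of $\theta$ in the pseudo-convex case). *)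

theory Defs
  imports "HOL-Analysis.Analysis" "HOL-Library.Function_Algebras"
begin

section \<open>Functions as a real vector space\<close>

instantiation "fun" :: (type, real_vector) real_vector
begin

definition scaleR_fun :: "real \<Rightarrow> ('a \<Rightarrow> 'b) \<Rightarrow> 'a \<Rightarrow> 'b"
  where "scaleR_fun r f = (\<lambda>x. r *\<^sub>R f x)"

instance
  by standard (auto simp: scaleR_fun_def fun_eq_iff scaleR_add_right scaleR_add_left)

end

section \<open>Smooth functions and smooth manifolds\<close>

primrec Ck_on :: "nat \<Rightarrow> 'e::real_normed_vector set \<Rightarrow> ('e \<Rightarrow> 'f::real_normed_vector) \<Rightarrow> bool"
  where
    "Ck_on 0 S f \<longleftrightarrow> continuous_on S f"
  | "Ck_on (Suc k) S f \<longleftrightarrow>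
       (\<forall>x\<in>S. f differentiable (at x)) \<and>
       (\<forall>v. Ck_on k S (\<lambda>x. frechet_derivative f (at x) v))"

text \<open>Used only for open subsets \<open>S\<close> of a finite-dimensional space, where this is
  the usual notion of a \<open>C\<^sup>\<infinity>\<close> map.\<close>

definition smooth_on :: "'e::real_normed_vector set \<Rightarrow> ('e \<Rightarrow> 'f::real_normed_vector) \<Rightarrow> bool"
  where "smooth_on S f \<longleftrightarrow> (\<forall>k. Ck_on k S f)"

text \<open>A chart is a pair of its domain and its coordinate map; the values of the map
  outside the domain are irrelevant. The manifold is the whole type \<open>'a\<close>.\<close>

type_synonym ('a, 'm) chart = "'a set \<times> ('a \<Rightarrow> real ^ 'm)"

definition chart_inv :: "('a, 'm) chart \<Rightarrow> real ^ 'm \<Rightarrow> 'a"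
  where "chart_inv c = inv_into (fst c) (snd c)"

definition transition :: "('a, 'm) chart \<Rightarrow> ('a, 'm) chart \<Rightarrow> real ^ 'm \<Rightarrow> real ^ 'm"
  where "transition c d = snd d \<circ> chart_inv c"

definition smooth_atlas ::
  "('a::{t2_space, second_countable_topology}, 'm::finite) chart set \<Rightarrow> bool"
  where "smooth_atlas \<A> \<longleftrightarrow>
    (\<Union>c\<in>\<A>. fst c) = UNIV \<and>
    (\<forall>c\<in>\<A>. open (fst c) \<and> open (snd c ` fst c) \<and>
       homeomorphism (fst c) (snd c ` fst c) (snd c) (chart_inv c)) \<and>
    (\<forall>c\<in>\<A>. \<forall>d\<in>\<A>. smooth_on (snd c ` (fst c \<inter> fst d)) (transition c d))"

definition oriented_atlas ::
  "('a::{t2_space, second_countable_topology}, 'm::finite) chart set \<Rightarrow> bool"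
  where "oriented_atlas \<A> \<longleftrightarrow> smooth_atlas \<A> \<and>
    (\<forall>c\<in>\<A>. \<forall>d\<in>\<A>. \<forall>y\<in>snd c ` (fst c \<inter> fst d).
       0 < det (matrix (frechet_derivative (transition c d) (at y))))"

section \<open>Tangent vectors, vector fields and one-forms\<close>

text \<open>A tangent vector is the family of its coordinate vectors in all charts around its
  base point, related by the Jacobians of the transition maps. As families are total
  functions, they are set to 0 at all other charts.\<close>

type_synonym ('a, 'm) tvec = "('a, 'm) chart \<Rightarrow> real ^ 'm"

definition charts_at :: "('a, 'm) chart set \<Rightarrow> 'a \<Rightarrow> ('a, 'm) chart set"
  where "charts_at \<A> p = {c \<in> \<A>. p \<in> fst c}"

definition tangent_space ::
  "('a, 'm::finite) chart set \<Rightarrow> 'a \<Rightarrow> ('a, 'm) tvec set"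
  where "tangent_space \<A> p = {v.
    (\<forall>c\<in>charts_at \<A> p. \<forall>d\<in>charts_at \<A> p.
       v d = frechet_derivative (transition c d) (at (snd c p)) (v c)) \<and>
    (\<forall>c. c \<notin> charts_at \<A> p \<longrightarrow> v c = 0)}"

text \<open>The tangent vector at \<open>p\<close> whose coordinate vector in the chart \<open>c\<close> is \<open>w\<close>.\<close>

definition coord_tvec ::
  "('a, 'm::finite) chart set \<Rightarrow> ('a, 'm) chart \<Rightarrow> 'a \<Rightarrow> real ^ 'm \<Rightarrow> ('a, 'm) tvec"
  where "coord_tvec \<A> c p w = (\<lambda>d. if d \<in> charts_at \<A> p
    then frechet_derivative (transition c d) (at (snd c p)) w else 0)"

definition smooth_vector_field ::
  "('a::topological_space, 'm::finite) chart set \<Rightarrow> 'a set \<Rightarrow> ('a \<Rightarrow> ('a, 'm) tvec) \<Rightarrow> bool"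
  where "smooth_vector_field \<A> U X \<longleftrightarrow>
    (\<forall>p\<in>U. X p \<in> tangent_space \<A> p) \<and>
    (\<forall>c\<in>\<A>. smooth_on (snd c ` (U \<inter> fst c)) (\<lambda>y. X (chart_inv c y) c))"

definition real_linear_on :: "'v::real_vector set \<Rightarrow> ('v \<Rightarrow> 'w::real_vector) \<Rightarrow> bool"
  where "real_linear_on S f \<longleftrightarrow>
    (\<forall>u\<in>S. \<forall>v\<in>S. f (u + v) = f u + f v) \<and> (\<forall>r. \<forall>v\<in>S. f (r *\<^sub>R v) = r *\<^sub>R f v)"

text \<open>In the chart \<open>c\<close> the form \<open>\<theta>\<close> reads \<open>y \<mapsto> (w \<mapsto> form_coeff \<A> \<theta> c y w)\<close>.\<close>

definition form_coeff ::
  "('a, 'm::finite) chart set \<Rightarrow> ('a \<Rightarrow> ('a, 'm) tvec \<Rightarrow> real) \<Rightarrow> ('a, 'm) chart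
    \<Rightarrow> real ^ 'm \<Rightarrow> real ^ 'm \<Rightarrow> real"
  where "form_coeff \<A> \<theta> c y w = \<theta> (chart_inv c y) (coord_tvec \<A> c (chart_inv c y) w)"

definition smooth_one_form ::
  "('a::topological_space, 'm::finite) chart set \<Rightarrow> 'a set \<Rightarrow> ('a \<Rightarrow> ('a, 'm) tvec \<Rightarrow> real) \<Rightarrow> bool"
  where "smooth_one_form \<A> U \<theta> \<longleftrightarrow>
    (\<forall>p\<in>U. real_linear_on (tangent_space \<A> p) (\<theta> p)) \<and>
    (\<forall>c\<in>\<A>. \<forall>w. smooth_on (snd c ` (U \<inter> fst c)) (\<lambda>y. form_coeff \<A> \<theta> c y w))"

text \<open>The exterior derivative, computed in a chart: in coordinates
  \<open>d\<theta>(u, v) = \<Sum>\<^sub>i\<^sub>j \<partial>\<^sub>i\<theta>\<^sub>j (u\<^sub>i v\<^sub>j - v\<^sub>i u\<^sub>j)\<close>, that is,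
  \<open>d\<theta>(X, Y) = X \<theta>(Y) - Y \<theta>(X) - \<theta>([X, Y])\<close> without a factor 1/2. By symmetry of the second
  derivatives of the transition maps the value is the same in every chart around \<open>p\<close>, so
  any of them may be chosen.\<close>

definition ext_deriv_in_chart ::
  "('a, 'm::finite) chart set \<Rightarrow> ('a, 'm) chart \<Rightarrow> ('a \<Rightarrow> ('a, 'm) tvec \<Rightarrow> real)
    \<Rightarrow> 'a \<Rightarrow> ('a, 'm) tvec \<Rightarrow> ('a, 'm) tvec \<Rightarrow> real"
  where "ext_deriv_in_chart \<A> c \<theta> p u v =
    frechet_derivative (\<lambda>y. form_coeff \<A> \<theta> c y (v c)) (at (snd c p)) (u c) -
    frechet_derivative (\<lambda>y. form_coeff \<A> \<theta> c y (u c)) (at (snd c p)) (v c)"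

definition ext_deriv ::
  "('a, 'm::finite) chart set \<Rightarrow> ('a \<Rightarrow> ('a, 'm) tvec \<Rightarrow> real)
    \<Rightarrow> 'a \<Rightarrow> ('a, 'm) tvec \<Rightarrow> ('a, 'm) tvec \<Rightarrow> real"
  where "ext_deriv \<A> \<theta> p = ext_deriv_in_chart \<A> (SOME c. c \<in> charts_at \<A> p) \<theta> p"

section \<open>Complexification\<close>

text \<open>The complexification of a real vector space consists of the pairs \<open>(u, w)\<close>, standing
  for \<open>u + \<i> w\<close>.\<close>

definition cscale :: "complex \<Rightarrow> 'v::real_vector \<times> 'v \<Rightarrow> 'v \<times> 'v"
  where "cscale z Z = (Re z *\<^sub>R fst Z - Im z *\<^sub>R snd Z, Re z *\<^sub>R snd Z + Im z *\<^sub>R fst Z)"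

interpretation complexification: vector_space cscale
  by standard (auto simp: cscale_def algebra_simps)

definition cconj :: "'v::real_vector \<times> 'v \<Rightarrow> 'v \<times> 'v"
  where "cconj Z = (fst Z, - snd Z)"

definition cbilinear_ext ::
  "('v::real_vector \<Rightarrow> 'v \<Rightarrow> real) \<Rightarrow> 'v \<times> 'v \<Rightarrow> 'v \<times> 'v \<Rightarrow> complex"
  where "cbilinear_ext b Z W =
    Complex (b (fst Z) (fst W) - b (snd Z) (snd W)) (b (fst Z) (snd W) + b (snd Z) (fst W))"

section \<open>CR structures of hypersurface type\<close>

definition smooth_subbundle ::
  "('a::topological_space, 'm::finite) chart set \<Rightarrow> nat \<Rightarrow> ('a \<Rightarrow> ('a, 'm) tvec set) \<Rightarrow> bool"
  where "smooth_subbundle \<A> r H \<longleftrightarrow>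
    (\<forall>p. \<exists>V E. open V \<and> p \<in> V \<and> (\<forall>i<r. smooth_vector_field \<A> V (E i)) \<and>
       (\<forall>x\<in>V. H x = span {E i x | i. i < r} \<and> dim (H x) = r))"

definition cr_structure ::
  "('a::topological_space, 'm::finite) chart set \<Rightarrow> ('a \<Rightarrow> ('a, 'm) tvec set)
    \<Rightarrow> ('a \<Rightarrow> ('a, 'm) tvec \<Rightarrow> ('a, 'm) tvec) \<Rightarrow> bool"
  where "cr_structure \<A> H J \<longleftrightarrow>
    smooth_subbundle \<A> (CARD('m) - 1) H \<and>
    (\<forall>p. real_linear_on (H p) (J p) \<and> bij_betw (J p) (H p) (H p) \<and>
       (\<forall>v\<in>H p. J p (J p v) = - v)) \<and>
    (\<forall>V X. open V \<and> smooth_vector_field \<A> V X \<and> (\<forall>p\<in>V. X p \<in> H p) \<longrightarrow>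
       smooth_vector_field \<A> V (\<lambda>p. J p (X p)))"

definition H10 ::
  "('a \<Rightarrow> ('a, 'm::finite) tvec set) \<Rightarrow> ('a \<Rightarrow> ('a, 'm) tvec \<Rightarrow> ('a, 'm) tvec) \<Rightarrow> 'a
    \<Rightarrow> (('a, 'm) tvec \<times> ('a, 'm) tvec) set"
  where "H10 H J p =
    {Z \<in> H p \<times> H p. (J p (fst Z), J p (snd Z)) = cscale \<i> Z}"

text \<open>\<open>\<theta>\<close> is a smooth non-vanishing real one-form on \<open>V\<close> with \<open>H(V) = \<theta>\<^sup>\<bottom>\<close>.\<close>

definition defining_form ::
  "('a::topological_space, 'm::finite) chart set \<Rightarrow> ('a \<Rightarrow> ('a, 'm) tvec set) \<Rightarrow> 'a set
    \<Rightarrow> ('a \<Rightarrow> ('a, 'm) tvec \<Rightarrow> real) \<Rightarrow> bool"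
  where "defining_form \<A> H V \<theta> \<longleftrightarrow>
    smooth_one_form \<A> V \<theta> \<and>
    (\<forall>p\<in>V. \<exists>v\<in>tangent_space \<A> p. \<theta> p v \<noteq> 0) \<and>
    (\<forall>p\<in>V. H p = {v \<in> tangent_space \<A> p. \<theta> p v = 0})"

definition levi_form ::
  "('a, 'm::finite) chart set \<Rightarrow> ('a \<Rightarrow> ('a, 'm) tvec \<Rightarrow> real) \<Rightarrow> 'a
    \<Rightarrow> ('a, 'm) tvec \<times> ('a, 'm) tvec \<Rightarrow> ('a, 'm) tvec \<times> ('a, 'm) tvec \<Rightarrow> complex"
  where "levi_form \<A> \<theta> p Z W = (1 / \<i>) * cbilinear_ext (ext_deriv \<A> \<theta> p) Z (cconj W)"

definition pseudoconvex ::
  "('a::topological_space, 'm::finite) chart set \<Rightarrow> ('a \<Rightarrow> ('a, 'm) tvec set)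
    \<Rightarrow> ('a \<Rightarrow> ('a, 'm) tvec \<Rightarrow> ('a, 'm) tvec) \<Rightarrow> bool"
  where "pseudoconvex \<A> H J \<longleftrightarrow>
    (\<forall>V \<theta> p. open V \<and> defining_form \<A> H V \<theta> \<and> p \<in> V \<longrightarrow>
       (\<forall>Z\<in>H10 H J p. levi_form \<A> \<theta> p Z Z \<in> \<real> \<and> 0 \<le> Re (levi_form \<A> \<theta> p Z Z)) \<or>
       (\<forall>Z\<in>H10 H J p. levi_form \<A> \<theta> p Z Z \<in> \<real> \<and> Re (levi_form \<A> \<theta> p Z Z) \<le> 0))"

definition levi_null_space ::
  "('a, 'm::finite) chart set \<Rightarrow> ('a \<Rightarrow> ('a, 'm) tvec set)
    \<Rightarrow> ('a \<Rightarrow> ('a, 'm) tvec \<Rightarrow> ('a, 'm) tvec) \<Rightarrow> ('a \<Rightarrow> ('a, 'm) tvec \<Rightarrow> real) \<Rightarrow> 'a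
    \<Rightarrow> (('a, 'm) tvec \<times> ('a, 'm) tvec) set"
  where "levi_null_space \<A> H J \<theta> p = {Z \<in> H10 H J p. levi_form \<A> \<theta> p Z Z = 0}"

text \<open>The points of nullity at least \<open>q\<close>, the nullity being computed with some local
  defining form near the point; all of them give the same null space.\<close>

definition nullity_ge_set ::
  "('a::topological_space, 'm::finite) chart set \<Rightarrow> ('a \<Rightarrow> ('a, 'm) tvec set)
    \<Rightarrow> ('a \<Rightarrow> ('a, 'm) tvec \<Rightarrow> ('a, 'm) tvec) \<Rightarrow> nat \<Rightarrow> 'a set"
  where "nullity_ge_set \<A> H J q = {p. \<exists>V \<theta>. open V \<and> p \<in> V \<and> defining_form \<A> H V \<theta> \<and>
    q \<le> complexification.dim (levi_null_space \<A> H J \<theta> p)}"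

definition L_field ::
  "('a \<Rightarrow> ('a, 'm::finite) tvec \<Rightarrow> ('a, 'm) tvec) \<Rightarrow> ('a \<Rightarrow> ('a, 'm) tvec) \<Rightarrow> 'a
    \<Rightarrow> ('a, 'm) tvec \<times> ('a, 'm) tvec"
  where "L_field J X p = (X p, - J p (X p))"

definition levi_matrix ::
  "('a, 'm::finite) chart set \<Rightarrow> ('a \<Rightarrow> ('a, 'm) tvec \<Rightarrow> ('a, 'm) tvec)
    \<Rightarrow> ('a \<Rightarrow> ('a, 'm) tvec \<Rightarrow> real) \<Rightarrow> ('n::finite \<Rightarrow> 'a \<Rightarrow> ('a, 'm) tvec) \<Rightarrow> 'a
    \<Rightarrow> complex ^ 'n ^ 'n"
  where "levi_matrix \<A> J \<theta> X p =
    (\<chi> j k. levi_form \<A> \<theta> p (L_field J (X j) p) (L_field J (X k) p))"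

definition pos_semidefinite :: "complex ^ 'n ^ 'n \<Rightarrow> bool"
  where "pos_semidefinite T \<longleftrightarrow>
    (\<forall>v :: complex ^ 'n.
       (\<Sum>j\<in>UNIV. \<Sum>k\<in>UNIV. v $ j * T $ j $ k * cnj (v $ k)) \<in> \<real> \<and>
       0 \<le> Re (\<Sum>j\<in>UNIV. \<Sum>k\<in>UNIV. v $ j * T $ j $ k * cnj (v $ k)))"

end

theory Submission
  imports Defs
begin

text \<open>Fix a point \<open>p\<close> of \<open>U\<close>. The vectors \<open>L\<^sub>j(p)\<close> form a complex basis of \<open>H\<^bsup>1,0\<^esup>\<close>: the \<open>2n\<close> real
  vectors \<open>X\<^sub>j, JX\<^sub>j\<close> span the \<open>2n\<close>-dimensional space \<open>H\<close>, hence are linearly independent over the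
  reals, and an element of \<open>H\<^bsup>1,0\<^esup>\<close> is determined by its real part
  (\<open>complex_combination_H10\<close>). In this basis the Levi form is the sesquilinear form of \<open>T\<close>. As
  \<open>T\<close> is positive semi-definite, the isotropic vectors of that form are the left kernel of \<open>T\<close>
  (\<open>sesq_form_null_iff_left_kernel\<close>), so the nullity computed with \<open>\<theta>\<close> is the dimension \<open>r\<close> of
  this kernel.

  It remains to compare \<open>r\<close> with the order of vanishing of \<open>det (T - \<mu>)\<close> at \<open>\<mu> = 0\<close>, which is
  at least \<open>q\<close> exactly when \<open>A\<^sub>0, \<dots>, A\<^bsub>q-1\<^esub>\<close> vanish. The two numbers agree, as they
  do for every diagonalizable matrix: in a basis of which \<open>r\<close> vectors span the kernel, \<open>r\<close> rows of \<open>T - \<mu>\<close> are divisible by \<open>- \<mu>\<close>, and what remains after dividing is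
  invertible at \<open>\<mu> = 0\<close> since the kernel of a semi-definite matrix meets its range only in 0
  (\<open>psd_char_poly_factorization\<close>).

  The sets of given nullity allow any local defining form. Two defining forms have the same
  kernel, so near \<open>p\<close> they satisfy \<open>\<theta>' = f \<theta>\<close>, and \<open>d\<theta>' = f d\<theta> + df \<and> \<theta>\<close> restricts to
  \<open>f d\<theta>\<close> on \<open>H\<close> (\<open>ext_deriv_proportional\<close>). Hence their Levi forms at \<open>p\<close> differ by a
  nonzero factor and have the same null space (\<open>levi_null_space_indep\<close>).\<close>

section \<open>Kernel and characteristic polynomial of semi-definite matrices\<close>

definition sesq_form :: "complex ^ 'n ^ 'n \<Rightarrow> complex ^ 'n \<Rightarrow> complex ^ 'n \<Rightarrow> complex"
  where "sesq_form T v w = (\<Sum>j\<in>UNIV. \<Sum>k\<in>UNIV. v $ j * T $ j $ k * cnj (w $ k))"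

lemma sesq_form_eq_row: "sesq_form T v w = (\<Sum>k\<in>UNIV. (v v* T) $ k * cnj (w $ k))"
  unfolding sesq_form_def
  by (subst sum.swap) (simp add: vector_matrix_mult_def sum_distrib_right mult.assoc)

lemma sesq_form_add_left: "sesq_form T (u + v) w = sesq_form T u w + sesq_form T v w"
  by (simp add: sesq_form_def algebra_simps sum.distrib)

lemma sesq_form_add_right: "sesq_form T u (v + w) = sesq_form T u v + sesq_form T u w"
  by (simp add: sesq_form_def algebra_simps sum.distrib)

lemma sesq_form_scale_left: "sesq_form T (z *s v) w = z * sesq_form T v w"
  by (simp add: sesq_form_def sum_distrib_left mult.assoc)

lemma sesq_form_scale_right: "sesq_form T v (z *s w) = cnj z * sesq_form T v w"
  by (simp add: sesq_form_def sum_distrib_left algebra_simps)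

lemma row_eq_zero_if_pairing_zero:
  fixes a :: "complex ^ 'n"
  assumes "(\<Sum>k\<in>UNIV. a $ k * cnj (a $ k)) = 0"
  shows "a = 0"
proof -
  have "(\<Sum>k\<in>UNIV. (cmod (a $ k))\<^sup>2) = 0"
    using assms by (simp only: complex_norm_square [symmetric] of_real_sum [symmetric] of_real_eq_0_iff)
  then have "\<forall>k. a $ k = 0"
    by (subst (asm) sum_nonneg_eq_0_iff) auto
  then show ?thesis
    by (simp add: vec_eq_iff)
qed

text \<open>On the line \<open>v + t w\<close> the form takes the values \<open>t s + t\<^sup>2 c\<close>, where \<open>s\<close> is the sum of the
  two mixed terms. These values are real and nonnegative for all real \<open>t\<close>, which forces \<open>s = 0\<close>;
  replacing \<open>w\<close> by \<open>\<i> w\<close> then separates the two mixed terms.\<close>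

lemma sesq_form_isotropic_null:
  fixes T :: "complex ^ 'n ^ 'n"
  assumes psd: "pos_semidefinite T" and v: "sesq_form T v v = 0"
  shows "sesq_form T v w = 0" and "sesq_form T w v = 0"
proof -
  have q: "sesq_form T u u \<in> \<real>" "0 \<le> Re (sesq_form T u u)" for u
    using psd unfolding pos_semidefinite_def sesq_form_def by blast+
  have sum0: "sesq_form T v w + sesq_form T w v = 0" for w
  proof (rule ccontr)
    let ?s = "sesq_form T v w + sesq_form T w v"
    let ?c = "Re (sesq_form T w w)"
    assume nz: "?s \<noteq> 0"
    have expand: "sesq_form T (v + of_real t *s w) (v + of_real t *s w) =
        of_real t * ?s + of_real (t\<^sup>2) * sesq_form T w w" for t
      by (simp add: sesq_form_add_left sesq_form_add_right sesq_form_scale_left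
          sesq_form_scale_right v algebra_simps power2_eq_square)
    have "Im ?s = 0"
      using q(1)[of "v + of_real 1 *s w"] q(1)[of w]
      unfolding expand by (simp add: complex_is_Real_iff)
    with nz have r: "Re ?s \<noteq> 0"
      by (simp add: complex_eq_iff)
    have nonneg: "0 \<le> t * Re ?s + t\<^sup>2 * ?c" for t
      using q(2)[of "v + of_real t *s w"] unfolding expand by simp
    \<comment> \<open>The polynomial \<open>t s + t\<^sup>2 c\<close> is negative strictly between 0 and \<open>- s / c\<close>; at \<open>- s / (1 + c)\<close> its value is
      \<open>- s\<^sup>2 / (1 + c)\<^sup>2 < 0\<close>; the summand 1 covers the case \<open>c = 0\<close>.\<close>
    define t where "t = - Re ?s / (1 + ?c)"
    have c: "0 \<le> ?c" by (rule q(2))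
    have "t * Re ?s + t\<^sup>2 * ?c = - (Re ?s)\<^sup>2 / (1 + ?c)\<^sup>2"
      using c unfolding t_def by (simp add: divide_simps power2_eq_square) algebra
    also have "\<dots> < 0"
      using r c by (simp add: divide_simps)
    finally show False
      using nonneg[of t] by linarith
  qed
  have "sesq_form T v w + sesq_form T w v = 0" "- \<i> * sesq_form T v w + \<i> * sesq_form T w v = 0"
    using sum0[of w] sum0[of "\<i> *s w"] by (simp_all add: sesq_form_scale_left sesq_form_scale_right)
  then show "sesq_form T v w = 0" "sesq_form T w v = 0"
    by (auto simp: complex_eq_iff)
qed

lemma sesq_form_null_iff_left_kernel:
  fixes T :: "complex ^ 'n ^ 'n"
  assumes "pos_semidefinite T"
  shows "sesq_form T v v = 0 \<longleftrightarrow> v v* T = 0"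
proof
  assume "sesq_form T v v = 0"
  then have "sesq_form T v (v v* T) = 0"
    using sesq_form_isotropic_null(1)[OF assms] by blast
  then show "v v* T = 0"
    unfolding sesq_form_eq_row by (rule row_eq_zero_if_pairing_zero)
next
  assume "v v* T = 0"
  then show "sesq_form T v v = 0"
    by (simp add: sesq_form_eq_row)
qed

text \<open>The kernel of a semi-definite matrix meets its range trivially: a vector \<open>a\<close> of the kernel
  is isotropic, so pairing \<open>b\<close> with \<open>a\<close> gives 0, but for \<open>a = b T\<close> this pairing is the squared
  norm of \<open>a\<close>.\<close>

lemma psd_left_kernel_inter_range:
  fixes T :: "complex ^ 'n ^ 'n"
  assumes psd: "pos_semidefinite T" and a: "a v* T = 0" and ab: "a = b v* T"
  shows "a = 0"
proof -
  have "sesq_form T b a = 0"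
    using sesq_form_isotropic_null(2)[OF psd] a
    by (simp add: sesq_form_eq_row)
  then show ?thesis
    unfolding sesq_form_eq_row ab[symmetric] by (rule row_eq_zero_if_pairing_zero)
qed

lemma vector_matrix_mult_rows:
  fixes P :: "'a::comm_semiring_1 ^ 'n ^ 'm"
  shows "x v* P = (\<Sum>i\<in>UNIV. x $ i *s (P $ i))"
  by (simp add: vec_eq_iff vector_matrix_mult_def)

lemma invertible_iff_left_kernel_trivial:
  fixes P :: "'a::field ^ 'n ^ 'n"
  shows "invertible P \<longleftrightarrow> (\<forall>x. x v* P = 0 \<longrightarrow> x = 0)"
proof -
  have "invertible P \<longleftrightarrow> invertible (transpose P)"
    by (simp add: invertible_det_nz)
  also have "\<dots> \<longleftrightarrow> (\<forall>x. transpose P *v x = 0 \<longrightarrow> x = 0)"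
    by (simp add: invertible_left_inverse matrix_left_invertible_ker)
  finally show ?thesis
    by simp
qed

text \<open>A basis of \<open>K\<close> extended to the whole space, written as the rows of a matrix: the rows with
  index in \<open>R\<close> form the basis of \<open>K\<close>. The set \<open>R\<close> replaces the first
  indices, as the index type carries no order.\<close>

lemma adapted_invertible_matrix:
  fixes K :: "('a::field ^ 'n) set"
  assumes K: "vec.subspace K"
  obtains P :: "'a ^ 'n ^ 'n" and R :: "'n set"
  where "invertible P" "card R = vec.dim K" "\<forall>i\<in>R. P $ i \<in> K"
    "\<forall>v\<in>K. \<exists>y. (\<forall>i. i \<notin> R \<longrightarrow> y $ i = 0) \<and> v = y v* P"
proof -
  obtain B where B: "B \<subseteq> K" "vec.independent B" "K \<subseteq> vec.span B" "card B = vec.dim K"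
    using vec.basis_exists .
  obtain C where C: "B \<subseteq> C" "vec.independent C" "UNIV \<subseteq> vec.span C"
    using vec.maximal_independent_subset_extend[of B UNIV] B(2) by auto
  have finC: "finite C"
    using C(2) by (rule vec.finiteI_independent)
  have "card C = CARD('n)"
    using vec.dim_unique[of C UNIV] C vec_dim_card by (metis subset_UNIV vec.basis_card_eq_dim)
  then obtain f :: "'n \<Rightarrow> 'a ^ 'n" where f: "bij_betw f UNIV C"
    using finite_same_card_bij[of "UNIV :: 'n set" C] finC by auto
  define P where "P = (\<chi> i. f i)"
  define R where "R = {i. f i \<in> B}"
  have fR: "bij_betw f R B"
  proof (rule bij_betw_subset[OF f])
    show "f ` R = B"
      using C(1) bij_betw_imp_surj_on[OF f] by (auto simp: R_def)
  qed simp
  have finB: "finite B"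
    using C(1) finC by (rule finite_subset)
  show ?thesis
  proof
    have "x = 0" if "x v* P = 0" for x
    proof -
      have "(\<Sum>b\<in>C. x $ (inv_into UNIV f b) *s b) = (\<Sum>i\<in>UNIV. x $ (inv_into UNIV f (f i)) *s f i)"
        by (rule sum.reindex_bij_betw[OF f, symmetric])
      also have "\<dots> = 0"
        using that bij_betw_imp_inj_on[OF f] by (simp add: vector_matrix_mult_rows P_def)
      finally have "\<forall>b\<in>C. x $ (inv_into UNIV f b) = 0"
        using C(2) vec.dependent_finite[OF finC] by auto
      then have "x $ inv_into UNIV f (f i) = 0" for i
        using bij_betwE[OF f] by blast
      then have "x $ i = 0" for i
        using bij_betw_imp_inj_on[OF f] by simp
      then show ?thesis
        by (simp add: vec_eq_iff)
    qed
    then show "invertible P"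
      by (simp add: invertible_iff_left_kernel_trivial)
    show "card R = vec.dim K"
      using bij_betw_same_card[OF fR] B(4) by simp
    show "\<forall>i\<in>R. P $ i \<in> K"
      using B(1) by (auto simp: R_def P_def)
    show "\<forall>v\<in>K. \<exists>y. (\<forall>i. i \<notin> R \<longrightarrow> y $ i = 0) \<and> v = y v* P"
    proof
      fix v assume "v \<in> K"
      obtain u where u: "v = (\<Sum>b\<in>B. u b *s b)"
        using \<open>v \<in> K\<close> B(3) unfolding vec.span_finite[OF finB] by blast
      define y where "y = (\<chi> i. if i \<in> R then u (f i) else 0)"
      have "v = (\<Sum>i\<in>R. u (f i) *s f i)"
        unfolding u by (rule sum.reindex_bij_betw[OF fR, symmetric])
      also have "\<dots> = (\<Sum>i\<in>UNIV. y $ i *s P $ i)"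
        by (rule sum.mono_neutral_cong_left) (auto simp: y_def P_def)
      finally have "v = y v* P"
        by (simp add: vector_matrix_mult_rows)
      then show "\<exists>y. (\<forall>i. i \<notin> R \<longrightarrow> y $ i = 0) \<and> v = y v* P"
        by (intro exI[of _ y]) (simp add: y_def)
    qed
  qed
qed

text \<open>The exponent is the geometric multiplicity of the eigenvalue 0, and \<open>g 0 \<noteq> 0\<close> says that
  it equals the algebraic one.\<close>

lemma psd_char_poly_factorization:
  fixes T :: "complex ^ 'n ^ 'n"
  assumes psd: "pos_semidefinite T"
  obtains g :: "complex \<Rightarrow> complex"
  where "continuous (at 0) g" "g 0 \<noteq> 0"
    "\<And>\<mu>. det (T - mat \<mu>) = (- \<mu>) ^ vec.dim {v. v v* T = 0} * g \<mu>"
proof -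
  define K where "K = {v. v v* T = 0}"
  have "vec.subspace K"
    by (auto simp: K_def vec.subspace_def vector_matrix_left_distrib scalar_vector_matrix_assoc)
  then obtain P :: "complex ^ 'n ^ 'n" and R :: "'n set" where P: "invertible P" and R: "card R = vec.dim K"
    and PK: "\<forall>i\<in>R. P $ i \<in> K"
    and KP: "\<forall>v\<in>K. \<exists>y. (\<forall>i. i \<notin> R \<longrightarrow> y $ i = 0) \<and> v = y v* P"
    by (rule adapted_invertible_matrix)
  \<comment> \<open>The rows of \<open>P (T - \<mu>)\<close>, where the factor \<open>- \<mu>\<close> has been taken out of the rows that
    lie in the kernel.\<close>
  define G where "G \<mu> = (\<chi> i. if i \<in> R then P $ i else P $ i v* (T - mat \<mu>))" for \<mu>
  have mat_scale: "v v* mat \<mu> = \<mu> *s v" for v :: "complex ^ 'n" and \<mu>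
    by (simp add: vec_eq_iff vector_matrix_mult_def mat_def if_distrib sum.delta cong: if_cong)
  have "P ** (T - mat \<mu>) = (\<chi> i. (if i \<in> R then - \<mu> else 1) *s G \<mu> $ i)" for \<mu>
  proof -
    have "P $ i v* (T - mat \<mu>) = - \<mu> *s P $ i" if "i \<in> R" for i
      using PK that by (simp add: K_def vector_matrix_mult_diff_rdistrib mat_scale)
    moreover have "(P ** M) $ i = P $ i v* M" for M :: "complex ^ 'n ^ 'n" and i
      by (simp add: vec_eq_iff matrix_matrix_mult_def vector_matrix_mult_def)
    ultimately show ?thesis
      by (simp add: vec_eq_iff G_def)
  qed
  then have detG: "det P * det (T - mat \<mu>) = (- \<mu>) ^ card R * det (G \<mu>)" for \<mu>
    by (simp add: det_rows_mul prod.If_cases flip: det_mul)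
  have detP: "det P \<noteq> 0"
    using P by (simp add: invertible_det_nz)
  have "mat 0 = (0 :: complex ^ 'n ^ 'n)"
    by (simp add: mat_def vec_eq_iff)
  then have G_zero: "G 0 = (\<chi> i. if i \<in> R then P $ i else P $ i v* T)"
    by (simp add: G_def cong: if_cong)
  \<comment> \<open>A relation between the rows of \<open>G 0\<close> has the form \<open>a + b T = 0\<close> with \<open>a\<close> in the kernel
    and \<open>b\<close> in the span of the rows outside \<open>R\<close>. So \<open>a\<close> lies in kernel and range and vanishes;
    then \<open>b\<close> is in the kernel, that is, in the span of the rows in \<open>R\<close>, and vanishes as well.\<close>
  have "x = 0" if x: "x v* G 0 = 0" for x
  proof -
    define a b where "a = (\<chi> i. if i \<in> R then x $ i else 0) v* P"
      and "b = (\<chi> i. if i \<in> R then 0 else x $ i) v* P"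
    have sum_K: "(\<Sum>i\<in>S. c i *s P $ i) \<in> K" if "S \<subseteq> R" for S c
      using that PK \<open>vec.subspace K\<close> by (intro vec.subspace_sum vec.subspace_scale) auto
    have "a = (\<Sum>i\<in>R. x $ i *s P $ i)"
      unfolding a_def vector_matrix_mult_rows
      by (rule sum.mono_neutral_cong_right) auto
    then have aK: "a \<in> K"
      using sum_K by simp
    have "a + b v* T = x v* G 0"
      unfolding a_def b_def vector_matrix_mul_assoc
      by (simp add: vec_eq_iff vector_matrix_mult_def G_zero matrix_matrix_mult_def
          flip: sum.distrib) (auto intro!: sum.cong simp: vector_matrix_mult_def)
    then have ab: "a = (- b) v* T"
      using x by (simp add: eq_neg_iff_add_eq_0 vec_eq_iff vector_matrix_mult_def sum_negf)
    have a0: "a = 0"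
      using psd_left_kernel_inter_range[OF psd _ ab] aK by (simp add: K_def)
    then have "b v* T = 0"
      using ab by (simp add: vec_eq_iff vector_matrix_mult_def sum_negf)
    then obtain y where y: "\<And>i. i \<notin> R \<Longrightarrow> y $ i = 0" "b = y v* P"
      using KP by (auto simp: K_def)
    have ker: "z = 0" if "z v* P = 0" for z
      using P that by (simp add: invertible_iff_left_kernel_trivial)
    have "(\<chi> i. if i \<in> R then 0 else x $ i) - y = 0"
      by (rule ker) (simp add: vector_matrix_mult_diff_distrib y(2)[symmetric] b_def[symmetric])
    moreover have "(\<chi> i. if i \<in> R then x $ i else 0) = 0"
      by (rule ker) (simp add: a0 a_def[symmetric])
    ultimately show ?thesis
      using y(1) by (auto simp: vec_eq_iff split: if_splits)
  qed
  then have "invertible (G 0)"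
    by (simp add: invertible_iff_left_kernel_trivial)
  then have detG0: "det (G 0) \<noteq> 0"
    by (simp add: invertible_det_nz)
  have "continuous (at 0) (\<lambda>\<mu>. (T - mat \<mu>) $ k $ j)" for k j
    by (cases "k = j") (auto simp: mat_def intro!: continuous_intros)
  then have G_cont: "continuous (at 0) (\<lambda>\<mu>. G \<mu> $ i $ j)" for i j
    by (cases "i \<in> R")
      (auto simp: G_def vector_matrix_mult_def simp del: vector_minus_component
        intro!: continuous_intros)
  have "continuous (at 0) (\<lambda>\<mu>. det (G \<mu>))"
    unfolding det_def
    by (intro continuous_sum continuous_mult continuous_const continuous_prod G_cont)
  show ?thesis
  proof
    show "continuous (at 0) (\<lambda>\<mu>. det (G \<mu>) / det P)"
      using detP \<open>continuous (at 0) (\<lambda>\<mu>. det (G \<mu>))\<close> by (intro continuous_intros) auto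
    show "det (G 0) / det P \<noteq> 0"
      using detP detG0 by simp
    show "det (T - mat \<mu>) = (- \<mu>) ^ vec.dim {v. v v* T = 0} * (det (G \<mu>) / det P)" for \<mu>
      using detG[of \<mu>] detP unfolding R K_def by (simp add: field_simps)
  qed
qed

text \<open>Here \<open>g\<close> is merely continuous, so that it may come from a quotient of determinants. If the
  order differed from \<open>r\<close>, cancelling the smaller power and letting \<open>x\<close> tend to 0 would make one
  of the two nonzero cofactors vanish at 0.\<close>

lemma order_zero_eqI:
  fixes p :: "complex poly"
  assumes g: "continuous (at 0) g" "g 0 \<noteq> 0"
    and p: "\<And>x. poly p x = x ^ r * g x" and "p \<noteq> 0"
  shows "order 0 p = r"
proof -
  obtain s where s: "p = [:- 0, 1:] ^ order 0 p * s" "\<not> [:- 0, 1:] dvd s"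
    using order_decomp[OF \<open>p \<noteq> 0\<close>, of 0] by blast
  let ?m = "order 0 p"
  have s0: "poly s 0 \<noteq> 0"
    using s(2) by (simp add: poly_eq_0_iff_dvd)
  have eq: "x ^ ?m * poly s x = x ^ r * g x" for x
    using p[of x] by (subst (asm) s(1)) simp
  have lim_s: "(poly s \<longlongrightarrow> poly s 0) (at 0)" and lim_g: "(g \<longlongrightarrow> g 0) (at 0)"
    using g(1) by (auto intro!: tendsto_intros simp: continuous_within)
  have lt: "\<not> a < b" if "\<And>x. x ^ a * f x = x ^ b * h x" "(f \<longlongrightarrow> f 0) (at 0)" "f 0 \<noteq> 0"
    "(h \<longlongrightarrow> h 0) (at 0)" for a b :: nat and f h :: "complex \<Rightarrow> complex"
  proof
    assume "a < b"
    have "f x = x ^ (b - a) * h x" if "x \<noteq> 0" for x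
      using \<open>a < b\<close> \<open>x ^ a * f x = x ^ b * h x\<close> that
      by (metis less_imp_add_positive add_diff_cancel_left' mult.assoc mult_cancel_left power_add power_not_zero)
    then have "\<forall>\<^sub>F x in at 0. f x = x ^ (b - a) * h x"
      by (auto simp: eventually_at_filter)
    moreover have "((\<lambda>x. x ^ (b - a) * h x) \<longlongrightarrow> 0 ^ (b - a) * h 0) (at 0)"
      by (intro tendsto_intros that(4))
    ultimately have "(f \<longlongrightarrow> 0) (at 0)"
      using \<open>a < b\<close> by (subst tendsto_cong) (auto simp: zero_power)
    then show False
      using that(2,3) tendsto_unique[of "at (0::complex)" f] by auto
  qed
  show ?thesis
    using lt[OF eq lim_s s0 lim_g] lt[OF eq[symmetric] lim_g g(2) lim_s] by linarith
qed

text \<open>The substitution \<open>x = - \<mu>\<close> turns the right-hand side of the expansion into a polynomial with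
  coefficients \<open>c k\<close>; it is monic, so its order at 0 is meaningful.\<close>

lemma psd_kernel_dim_ge_iff:
  fixes T :: "complex ^ 'n ^ 'n" and c :: "nat \<Rightarrow> complex"
  assumes psd: "pos_semidefinite T"
    and char: "\<And>\<mu>. det (T - mat \<mu>) = (\<Sum>k = 0..CARD('n) - 1. c k * (- \<mu>) ^ k) + (- \<mu>) ^ CARD('n)"
    and q: "q \<le> CARD('n)"
  shows "q \<le> vec.dim {v. v v* T = 0} \<longleftrightarrow> (\<forall>j<q. c j = 0)"
proof -
  define p where "p = (\<Sum>k = 0..CARD('n) - 1. monom (c k) k) + monom 1 (CARD('n))"
  have pos: "0 < CARD('n)" by simp
  have coeff_p: "coeff p j = (if j < CARD('n) then c j else if j = CARD('n) then 1 else 0)" for j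
    using pos by (auto simp: p_def coeff_sum)
  then have "coeff p (CARD('n)) \<noteq> 0"
    by simp
  then have "p \<noteq> 0"
    by auto
  obtain g where g: "continuous (at 0) g" "g 0 \<noteq> 0"
    "\<And>\<mu>. det (T - mat \<mu>) = (- \<mu>) ^ vec.dim {v. v v* T = 0} * g \<mu>"
    using psd_char_poly_factorization[OF psd] by blast
  have "order 0 p = vec.dim {v. v v* T = 0}"
  proof (rule order_zero_eqI[where g = "\<lambda>x. g (- x)"])
    show "continuous (at 0) (\<lambda>x. g (- x))"
      by (rule continuous_at_compose[of _ uminus g, unfolded o_def])
        (auto intro!: continuous_intros simp: g)
    show "poly p x = x ^ vec.dim {v. v v* T = 0} * g (- x)" for x
      using g(3)[of "- x"] char[of "- x"] by (simp add: p_def poly_sum poly_monom)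
  qed (use g \<open>p \<noteq> 0\<close> in auto)
  then have "q \<le> vec.dim {v. v v* T = 0} \<longleftrightarrow> monom 1 q dvd p"
    using monom_1_dvd_iff[OF \<open>p \<noteq> 0\<close>] by simp
  then show ?thesis
    using q by (auto simp: monom_1_dvd_iff' coeff_p)
qed

section \<open>Tangent vectors and one-forms in charts\<close>

lemma smooth_on_differentiable:
  assumes "smooth_on S f" "x \<in> S"
  shows "f differentiable (at x)"
proof -
  have "Ck_on (Suc 0) S f"
    using assms(1) unfolding smooth_on_def by blast
  then show ?thesis
    using assms(2) by simp
qed

lemma chart_inv_left:
  assumes "smooth_atlas \<A>" "c \<in> \<A>" "x \<in> fst c"
  shows "chart_inv c (snd c x) = x"
  using assms by (auto simp: smooth_atlas_def homeomorphism_def)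

lemma open_chart_image:
  assumes "smooth_atlas \<A>" "c \<in> \<A>" "open W"
  shows "open (snd c ` (W \<inter> fst c))"
proof -
  have hom: "homeomorphism (fst c) (snd c ` fst c) (snd c) (chart_inv c)"
    and opn: "open (snd c ` fst c)"
    using assms(1,2) by (auto simp: smooth_atlas_def)
  have "openin (top_of_set (snd c ` fst c)) (snd c ` (W \<inter> fst c))"
    using assms(3) by (intro homeomorphism_imp_open_map[OF hom]) (auto simp: openin_open)
  then show ?thesis
    using opn by (rule openin_open_trans)
qed

lemma transition_differentiable:
  assumes "smooth_atlas \<A>" "c \<in> charts_at \<A> p" "d \<in> charts_at \<A> p"
  shows "transition c d differentiable (at (snd c p))"
proof (rule smooth_on_differentiable)
  show "smooth_on (snd c ` (fst c \<inter> fst d)) (transition c d)"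
    using assms unfolding smooth_atlas_def charts_at_def by blast
  show "snd c p \<in> snd c ` (fst c \<inter> fst d)"
    using assms(2,3) by (simp add: charts_at_def)
qed

lemma transition_derivative_linear:
  assumes "smooth_atlas \<A>" "c \<in> charts_at \<A> p" "d \<in> charts_at \<A> p"
  shows "linear (frechet_derivative (transition c d) (at (snd c p)))"
  using transition_differentiable[OF assms] by (rule linear_frechet_derivative)

text \<open>The chain rule; it makes the family \<open>coord_tvec\<close> of coordinate vectors consistent, hence an
  actual tangent vector.\<close>

lemma transition_derivative_cocycle:
  assumes A: "smooth_atlas \<A>"
    and c: "c \<in> charts_at \<A> p" and d: "d \<in> charts_at \<A> p" and e: "e \<in> charts_at \<A> p"
  shows "frechet_derivative (transition c e) (at (snd c p)) =
    frechet_derivative (transition d e) (at (snd d p)) \<circ>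
    frechet_derivative (transition c d) (at (snd c p))"
proof -
  have mem: "c \<in> \<A>" "p \<in> fst c" "d \<in> \<A>" "p \<in> fst d" "p \<in> fst e" "e \<in> \<A>"
    using c d e by (auto simp: charts_at_def)
  have at_p: "transition c d (snd c p) = snd d p"
    using mem chart_inv_left[OF A] by (simp add: transition_def)
  let ?W = "snd c ` (fst d \<inter> fst e \<inter> fst c)"
  have "open (fst d \<inter> fst e)"
    using A mem by (auto simp: smooth_atlas_def)
  then have opn: "open ?W"
    by (rule open_chart_image[OF A mem(1)])
  have eq: "transition c e y = (transition d e \<circ> transition c d) y" if "y \<in> ?W" for y
  proof -
    obtain x where x: "y = snd c x" "x \<in> fst c" "x \<in> fst d"
      using \<open>y \<in> ?W\<close> by blast
    then have "chart_inv c y = x" "chart_inv d (snd d x) = x"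
      using mem by (simp_all add: chart_inv_left[OF A])
    then show ?thesis
      by (simp add: transition_def)
  qed
  have "frechet_derivative (transition c e) (at (snd c p)) =
      frechet_derivative (transition d e \<circ> transition c d) (at (snd c p))"
    using opn mem eq
    by (intro frechet_derivative_transform_within_open[OF transition_differentiable[OF A c e]]) auto
  also have "\<dots> = frechet_derivative (transition d e) (at (transition c d (snd c p))) \<circ>
      frechet_derivative (transition c d) (at (snd c p))"
    using transition_differentiable[OF A c d] transition_differentiable[OF A d e]
    by (intro frechet_derivative_compose) (auto simp: at_p)
  finally show ?thesis
    by (simp add: at_p)
qed

lemma coord_tvec_in_tangent_space:
  assumes A: "smooth_atlas \<A>" and c: "c \<in> charts_at \<A> p"
  shows "coord_tvec \<A> c p w \<in> tangent_space \<A> p"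
  unfolding tangent_space_def mem_Collect_eq
proof (intro conjI ballI allI impI)
  fix d e assume d: "d \<in> charts_at \<A> p" and e: "e \<in> charts_at \<A> p"
  show "coord_tvec \<A> c p w e =
      frechet_derivative (transition d e) (at (snd d p)) (coord_tvec \<A> c p w d)"
    using d e by (simp add: coord_tvec_def transition_derivative_cocycle[OF A c d e])
next
  fix d assume "d \<notin> charts_at \<A> p"
  then show "coord_tvec \<A> c p w d = 0"
    by (simp add: coord_tvec_def)
qed

lemma coord_tvec_of_tangent:
  assumes "v \<in> tangent_space \<A> p" "c \<in> charts_at \<A> p"
  shows "coord_tvec \<A> c p (v c) = v"
proof (rule ext)
  fix d
  show "coord_tvec \<A> c p (v c) d = v d"
  proof (cases "d \<in> charts_at \<A> p")
    case True
    then have "v d = frechet_derivative (transition c d) (at (snd c p)) (v c)"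
      using assms unfolding tangent_space_def by blast
    then show ?thesis
      using True by (simp add: coord_tvec_def)
  next
    case False
    then have "v d = 0"
      using assms(1) unfolding tangent_space_def by blast
    then show ?thesis
      using False by (simp add: coord_tvec_def)
  qed
qed

lemma coord_tvec_linear:
  assumes A: "smooth_atlas \<A>" and c: "c \<in> charts_at \<A> p"
  shows "linear (coord_tvec \<A> c p)"
proof (rule linearI)
  note lin = transition_derivative_linear[OF A c]
  show "coord_tvec \<A> c p (v + w) = coord_tvec \<A> c p v + coord_tvec \<A> c p w" for v w
    by (auto simp: coord_tvec_def fun_eq_iff linear_add[OF lin])
  show "coord_tvec \<A> c p (r *\<^sub>R w) = r *\<^sub>R coord_tvec \<A> c p w" for r w
    by (auto simp: coord_tvec_def fun_eq_iff scaleR_fun_def linear_scale[OF lin])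
qed

lemma tangent_space_subspace:
  assumes A: "smooth_atlas \<A>" and c: "c \<in> charts_at \<A> p"
  shows "subspace (tangent_space \<A> p)"
proof -
  have "tangent_space \<A> p = range (coord_tvec \<A> c p)"
    using coord_tvec_in_tangent_space[OF A c] coord_tvec_of_tangent[OF _ c] by (auto intro: range_eqI[OF sym])
  then show ?thesis
    using linear_subspace_image[OF coord_tvec_linear[OF A c] subspace_UNIV] by simp
qed

lemma form_coeff_linear:
  assumes A: "smooth_atlas \<A>" and \<theta>: "smooth_one_form \<A> V \<theta>"
    and c: "c \<in> \<A>" and y: "y \<in> snd c ` (V \<inter> fst c)"
  shows "linear (form_coeff \<A> \<theta> c y)"
proof -
  obtain x where x: "y = snd c x" "x \<in> V" "x \<in> fst c"
    using y by blast
  then have at: "c \<in> charts_at \<A> x" and inv: "chart_inv c y = x"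
    using c chart_inv_left[OF A c] by (auto simp: charts_at_def)
  have rl: "real_linear_on (tangent_space \<A> x) (\<theta> x)"
    using \<theta> x(2) by (simp add: smooth_one_form_def)
  show ?thesis
  proof (rule linearI)
    show "form_coeff \<A> \<theta> c y (v + w) = form_coeff \<A> \<theta> c y v + form_coeff \<A> \<theta> c y w" for v w
      using rl coord_tvec_in_tangent_space[OF A at]
      by (simp add: form_coeff_def inv linear_add[OF coord_tvec_linear[OF A at]] real_linear_on_def)
    show "form_coeff \<A> \<theta> c y (r *\<^sub>R w) = r *\<^sub>R form_coeff \<A> \<theta> c y w" for r w
      using rl coord_tvec_in_tangent_space[OF A at]
      by (simp add: form_coeff_def inv linear_scale[OF coord_tvec_linear[OF A at]] real_linear_on_def)
  qed
qed

lemma form_coeff_at_point: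
  assumes A: "smooth_atlas \<A>" and c: "c \<in> charts_at \<A> p" and v: "v \<in> tangent_space \<A> p"
  shows "form_coeff \<A> \<theta> c (snd c p) (v c) = \<theta> p v"
  using c chart_inv_left[OF A] coord_tvec_of_tangent[OF v c]
  by (simp add: form_coeff_def charts_at_def)

lemma form_coeff_has_derivative:
  assumes "smooth_one_form \<A> V \<theta>" "c \<in> \<A>" "y \<in> snd c ` (V \<inter> fst c)"
  shows "((\<lambda>y. form_coeff \<A> \<theta> c y w) has_derivative
    frechet_derivative (\<lambda>y. form_coeff \<A> \<theta> c y w) (at y)) (at y)"
proof -
  have "smooth_on (snd c ` (V \<inter> fst c)) (\<lambda>y. form_coeff \<A> \<theta> c y w)"
    using assms by (simp add: smooth_one_form_def)
  then show ?thesis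
    using assms(3) smooth_on_differentiable frechet_derivative_works by blast
qed

lemma some_chart_at:
  assumes "smooth_atlas \<A>"
  shows "(SOME c. c \<in> charts_at \<A> p) \<in> charts_at \<A> p"
proof -
  have "\<exists>c. c \<in> charts_at \<A> p"
    using assms unfolding smooth_atlas_def charts_at_def by blast
  then show ?thesis
    by (rule someI_ex)
qed

text \<open>Bilinearity is not evident in either argument: each one enters once as the direction of
  differentiation and once as a constant coordinate vector under the derivative. The directional
  derivative is linear in the direction, and linearity in the constant vector follows because
  the coefficients of \<open>\<theta>\<close> are linear on a whole neighbourhood of \<open>p\<close>.\<close>

lemma ext_deriv_bilinear:
  assumes A: "smooth_atlas \<A>" and V: "open V" "p \<in> V" and \<theta>: "smooth_one_form \<A> V \<theta>"
  shows "bilinear (ext_deriv \<A> \<theta> p)"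
proof -
  define c where "c = (SOME c. c \<in> charts_at \<A> p)"
  have c: "c \<in> \<A>" "p \<in> fst c"
    using some_chart_at[OF A, of p] by (auto simp: c_def charts_at_def)
  let ?S = "snd c ` (V \<inter> fst c)"
  define y where "y = snd c p"
  have y: "y \<in> ?S"
    using V c by (auto simp: y_def)
  have opn: "open ?S"
    using A c V by (intro open_chart_image)
  define D where "D w = frechet_derivative (\<lambda>y. form_coeff \<A> \<theta> c y w) (at y)" for w
  have der: "((\<lambda>y. form_coeff \<A> \<theta> c y w) has_derivative D w) (at y)" for w
    unfolding D_def by (rule form_coeff_has_derivative[OF \<theta> c(1) y])
  have D_lin: "linear (D w)" for w
    using der by (rule has_derivative_linear)
  have D_add: "D (v + w) h = D v h + D w h" for v w h
  proof -
    have "((\<lambda>y. form_coeff \<A> \<theta> c y (v + w)) has_derivative (\<lambda>h. D v h + D w h)) (at y)"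
      by (rule has_derivative_transform_within_open[OF has_derivative_add[OF der der] opn y])
        (simp add: linear_add[OF form_coeff_linear[OF A \<theta> c(1)]])
    then show ?thesis
      using has_derivative_unique[OF der] by (metis (no_types))
  qed
  have D_scale: "D (r *\<^sub>R w) h = r * D w h" for r w h
  proof -
    have "((\<lambda>y. form_coeff \<A> \<theta> c y (r *\<^sub>R w)) has_derivative (\<lambda>h. r *\<^sub>R D w h)) (at y)"
      by (rule has_derivative_transform_within_open[OF has_derivative_scaleR_right[OF der] opn y])
        (simp add: linear_scale[OF form_coeff_linear[OF A \<theta> c(1)]])
    from has_derivative_unique[OF der this] show ?thesis
      by simp
  qed
  have ext: "ext_deriv \<A> \<theta> p u v = D (v c) (u c) - D (u c) (v c)" for u v
    by (simp add: ext_deriv_def c_def[symmetric] ext_deriv_in_chart_def D_def y_def)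
  show ?thesis
    unfolding bilinear_def linear_iff ext
    by (simp add: D_add D_scale scaleR_fun_def right_diff_distrib
        linear_add[OF D_lin] linear_scale[OF D_lin])
qed

text \<open>Cross multiplication expresses that two functionals with the same kernel are proportional
  without dividing: the vector \<open>\<theta>(w) v - \<theta>(v) w\<close> is in the kernel of \<open>\<theta>\<close>, hence of \<open>\<theta>'\<close>.\<close>

lemma proportional_if_same_kernel:
  assumes \<theta>: "real_linear_on S \<theta>" and \<theta>': "real_linear_on S \<theta>'" and S: "subspace S"
    and ker: "{v \<in> S. \<theta> v = 0} = {v \<in> S. \<theta>' v = (0::real)}"
    and v: "v \<in> S" and w: "w \<in> S"
  shows "\<theta>' v * \<theta> w = \<theta> v * (\<theta>' w :: real)"
proof -
  let ?u = "\<theta> w *\<^sub>R v + (- \<theta> v) *\<^sub>R w"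
  have u: "?u \<in> S"
    using S v w by (intro subspace_add subspace_scale)
  have val: "\<phi> ?u = \<theta> w * \<phi> v - \<theta> v * \<phi> w" if "real_linear_on S \<phi>" for \<phi> :: "'a \<Rightarrow> real"
  proof -
    have "\<phi> ?u = \<phi> (\<theta> w *\<^sub>R v) + \<phi> ((- \<theta> v) *\<^sub>R w)"
      using that S v w subspace_scale unfolding real_linear_on_def by blast
    also have "\<dots> = \<theta> w *\<^sub>R \<phi> v + (- \<theta> v) *\<^sub>R \<phi> w"
      using that v w unfolding real_linear_on_def by metis
    finally show ?thesis
      by simp
  qed
  have "\<theta> ?u = 0"
    unfolding val[OF \<theta>] by simp
  then have "\<theta>' ?u = 0"
    using ker u by blast
  then show ?thesis
    unfolding val[OF \<theta>'] by (simp add: mult.commute)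
qed

text \<open>Differentiating \<open>\<theta>'(v) \<theta>(w) = \<theta>(v) \<theta>'(w)\<close> at \<open>p\<close>, for constant coordinate vectors \<open>v\<close> in
  \<open>H p\<close> and \<open>w\<close> outside it, leaves only the derivatives of \<open>\<theta>'(v)\<close> and \<open>\<theta>(v)\<close>, because both
  forms vanish on \<open>v\<close> at \<open>p\<close>. The factor is therefore \<open>\<theta>'(w) / \<theta>(w)\<close> at \<open>p\<close>.\<close>

lemma ext_deriv_proportional:
  assumes A: "smooth_atlas \<A>" and V: "open V" "p \<in> V" "defining_form \<A> H V \<theta>"
    and V': "open V'" "p \<in> V'" "defining_form \<A> H V' \<theta>'"
  obtains r where "r \<noteq> 0"
    "\<forall>u\<in>H p. \<forall>v\<in>H p. ext_deriv \<A> \<theta>' p u v = r * ext_deriv \<A> \<theta> p u v"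
proof -
  define c where "c = (SOME c. c \<in> charts_at \<A> p)"
  have c: "c \<in> \<A>" "p \<in> fst c" and cp: "c \<in> charts_at \<A> p"
    using some_chart_at[OF A, of p] by (auto simp: c_def charts_at_def)
  let ?S = "snd c ` (V \<inter> V' \<inter> fst c)"
  define y where "y = snd c p"
  have y: "y \<in> ?S" and yV: "y \<in> snd c ` (V \<inter> fst c)" and yV': "y \<in> snd c ` (V' \<inter> fst c)"
    using V V' c by (auto simp: y_def)
  have opn: "open ?S"
    using A c V V' by (intro open_chart_image) auto
  have sm: "smooth_one_form \<A> V \<theta>" "smooth_one_form \<A> V' \<theta>'"
    using V V' by (auto simp: defining_form_def)
  define F F' where "F w y = form_coeff \<A> \<theta> c y w" and "F' w y = form_coeff \<A> \<theta>' c y w" for w y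
  define D D' where "D w = frechet_derivative (F w) (at y)"
    and "D' w = frechet_derivative (F' w) (at y)" for w
  have der: "(F w has_derivative D w) (at y)" "(F' w has_derivative D' w) (at y)" for w
    using form_coeff_has_derivative[OF sm(1) c(1) yV] form_coeff_has_derivative[OF sm(2) c(1) yV']
    by (simp_all add: F_def[abs_def] F'_def[abs_def] D_def D'_def)
  have same_ratio: "F' v z * F w z = F v z * F' w z" if z: "z \<in> ?S" for v w z
  proof -
    obtain x where x: "z = snd c x" "x \<in> V" "x \<in> V'" "x \<in> fst c"
      using z by blast
    then have at: "c \<in> charts_at \<A> x" and inv: "chart_inv c z = x"
      using c chart_inv_left[OF A] by (auto simp: charts_at_def)
    have "H x = {v \<in> tangent_space \<A> x. \<theta> x v = 0}" "H x = {v \<in> tangent_space \<A> x. \<theta>' x v = 0}"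
      using V(3) V'(3) x(2,3) unfolding defining_form_def by blast+
    then have ker: "{v \<in> tangent_space \<A> x. \<theta> x v = 0} = {v \<in> tangent_space \<A> x. \<theta>' x v = 0}"
      by simp
    have rl: "real_linear_on (tangent_space \<A> x) (\<theta> x)" "real_linear_on (tangent_space \<A> x) (\<theta>' x)"
      using sm x(2,3) by (simp_all add: smooth_one_form_def)
    show ?thesis
      unfolding F_def F'_def form_coeff_def inv
      by (rule proportional_if_same_kernel[OF rl tangent_space_subspace[OF A at] ker
            coord_tvec_in_tangent_space[OF A at] coord_tvec_in_tangent_space[OF A at]])
  qed
  obtain w0 where w0: "w0 \<in> tangent_space \<A> p" "\<theta> p w0 \<noteq> 0"
    using V unfolding defining_form_def by blast
  have Hp: "H p = {v \<in> tangent_space \<A> p. \<theta> p v = 0}" "H p = {v \<in> tangent_space \<A> p. \<theta>' p v = 0}"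
    using V V' unfolding defining_form_def by blast+
  have w0': "\<theta>' p w0 \<noteq> 0"
    using w0 Hp by blast
  have key: "\<theta> p w0 * D' (v c) h = \<theta>' p w0 * D (v c) h" if v: "v \<in> H p" for v h
  proof -
    have vt: "v \<in> tangent_space \<A> p" and v0: "\<theta> p v = 0" "\<theta>' p v = 0"
      using v Hp by blast+
    have F_v: "F (v c) y = 0" "F' (v c) y = 0" and F_w: "F (w0 c) y = \<theta> p w0" "F' (w0 c) y = \<theta>' p w0"
      unfolding F_def F'_def y_def
      by (simp_all add: form_coeff_at_point[OF A cp vt] form_coeff_at_point[OF A cp w0(1)] v0)
    have "((\<lambda>z. F' (v c) z * F (w0 c) z) has_derivative
        (\<lambda>h. F' (v c) y * D (w0 c) h + D' (v c) h * F (w0 c) y)) (at y)"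
      by (intro has_derivative_mult der)
    then have "((\<lambda>z. F (v c) z * F' (w0 c) z) has_derivative
        (\<lambda>h. F' (v c) y * D (w0 c) h + D' (v c) h * F (w0 c) y)) (at y)"
      by (rule has_derivative_transform_within_open[OF _ opn y]) (rule same_ratio)
    moreover have "((\<lambda>z. F (v c) z * F' (w0 c) z) has_derivative
        (\<lambda>h. F (v c) y * D' (w0 c) h + D (v c) h * F' (w0 c) y)) (at y)"
      by (intro has_derivative_mult der)
    ultimately have "(\<lambda>h. F' (v c) y * D (w0 c) h + D' (v c) h * F (w0 c) y) =
        (\<lambda>h. F (v c) y * D' (w0 c) h + D (v c) h * F' (w0 c) y)"
      by (rule has_derivative_unique)
    from fun_cong[OF this, of h] show ?thesis
      by (simp add: F_v F_w mult.commute)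
  qed
  have ext: "ext_deriv \<A> \<theta> p u v = D (v c) (u c) - D (u c) (v c)"
    "ext_deriv \<A> \<theta>' p u v = D' (v c) (u c) - D' (u c) (v c)" for u v
    by (simp_all add: ext_deriv_def c_def[symmetric] ext_deriv_in_chart_def D_def D'_def y_def
        F_def[abs_def] F'_def[abs_def])
  show ?thesis
  proof
    show "\<theta>' p w0 / \<theta> p w0 \<noteq> 0"
      using w0 w0' by simp
    show "\<forall>u\<in>H p. \<forall>v\<in>H p. ext_deriv \<A> \<theta>' p u v = \<theta>' p w0 / \<theta> p w0 * ext_deriv \<A> \<theta> p u v"
    proof (intro ballI)
      fix u v assume "u \<in> H p" "v \<in> H p"
      then show "ext_deriv \<A> \<theta>' p u v = \<theta>' p w0 / \<theta> p w0 * ext_deriv \<A> \<theta> p u v"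
        using key[of u "v c"] key[of v "u c"] w0(2) by (simp add: ext field_simps)
    qed
  qed
qed

section \<open>The Levi form\<close>

text \<open>With the conjugation and the factor \<open>1 / \<i>\<close> multiplied out, sesquilinearity of the Levi form
  and its dependence on \<open>\<theta>\<close> become statements about real values of \<open>d\<theta>\<close>.\<close>

lemma levi_form_components:
  assumes "bilinear (ext_deriv \<A> \<theta> p)"
  shows "levi_form \<A> \<theta> p Z W =
    Complex (ext_deriv \<A> \<theta> p (snd Z) (fst W) - ext_deriv \<A> \<theta> p (fst Z) (snd W))
      (- ext_deriv \<A> \<theta> p (fst Z) (fst W) - ext_deriv \<A> \<theta> p (snd Z) (snd W))"
proof -
  have div_i: "(1 / \<i>) * Complex a b = Complex b (- a)" for a b
    by (simp add: complex_eq_iff)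
  show ?thesis
    unfolding levi_form_def cbilinear_ext_def div_i
    by (simp add: cconj_def bilinear_rneg[OF assms])
qed

lemma levi_null_space_indep:
  assumes A: "smooth_atlas \<A>" and V: "open V" "p \<in> V" "defining_form \<A> H V \<theta>"
    and V': "open V'" "p \<in> V'" "defining_form \<A> H V' \<theta>'"
  shows "levi_null_space \<A> H J \<theta>' p = levi_null_space \<A> H J \<theta> p"
proof -
  obtain r where r: "r \<noteq> 0"
    "\<forall>u\<in>H p. \<forall>v\<in>H p. ext_deriv \<A> \<theta>' p u v = r * ext_deriv \<A> \<theta> p u v"
    by (rule ext_deriv_proportional[OF A V V'])
  have "smooth_one_form \<A> V \<theta>" "smooth_one_form \<A> V' \<theta>'"
    using V(3) V'(3) by (simp_all add: defining_form_def)
  then have bil: "bilinear (ext_deriv \<A> \<theta> p)" "bilinear (ext_deriv \<A> \<theta>' p)"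
    using ext_deriv_bilinear[OF A V(1,2)] ext_deriv_bilinear[OF A V'(1,2)] by blast+
  have "levi_form \<A> \<theta>' p Z Z = of_real r * levi_form \<A> \<theta> p Z Z" if "Z \<in> H10 H J p" for Z
  proof -
    have "fst Z \<in> H p" "snd Z \<in> H p"
      using that unfolding H10_def by auto
    then show ?thesis
      unfolding levi_form_components[OF bil(1)] levi_form_components[OF bil(2)]
      by (simp add: r(2) complex_eq_iff right_diff_distrib)
  qed
  then show ?thesis
    using r(1) unfolding levi_null_space_def by auto
qed

lemma levi_form_add_left:
  assumes "bilinear (ext_deriv \<A> \<theta> p)"
  shows "levi_form \<A> \<theta> p (Z + Z') W = levi_form \<A> \<theta> p Z W + levi_form \<A> \<theta> p Z' W"
  by (simp add: levi_form_components[OF assms] bilinear_ladd[OF assms] complex_eq_iff)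

lemma levi_form_add_right:
  assumes "bilinear (ext_deriv \<A> \<theta> p)"
  shows "levi_form \<A> \<theta> p Z (W + W') = levi_form \<A> \<theta> p Z W + levi_form \<A> \<theta> p Z W'"
  by (simp add: levi_form_components[OF assms] bilinear_radd[OF assms] complex_eq_iff)

lemma levi_form_scale_left:
  assumes "bilinear (ext_deriv \<A> \<theta> p)"
  shows "levi_form \<A> \<theta> p (cscale z Z) W = z * levi_form \<A> \<theta> p Z W"
  by (simp add: levi_form_components[OF assms] cscale_def bilinear_ladd[OF assms]
      bilinear_lsub[OF assms] bilinear_lmul[OF assms] complex_eq_iff right_diff_distrib)

lemma levi_form_scale_right:
  assumes "bilinear (ext_deriv \<A> \<theta> p)"
  shows "levi_form \<A> \<theta> p Z (cscale z W) = cnj z * levi_form \<A> \<theta> p Z W"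
  by (simp add: levi_form_components[OF assms] cscale_def bilinear_radd[OF assms]
      bilinear_rsub[OF assms] bilinear_rmul[OF assms] complex_eq_iff right_diff_distrib)

lemma levi_form_sum_left:
  assumes "bilinear (ext_deriv \<A> \<theta> p)"
  shows "levi_form \<A> \<theta> p (\<Sum>j\<in>S. Z j) W = (\<Sum>j\<in>S. levi_form \<A> \<theta> p (Z j) W)"
proof -
  have "levi_form \<A> \<theta> p 0 W = 0"
    using levi_form_add_left[OF assms, of 0 0 W] by simp
  then show ?thesis
    by (induction S rule: infinite_finite_induct) (auto simp: levi_form_add_left[OF assms])
qed

lemma levi_form_sum_right:
  assumes "bilinear (ext_deriv \<A> \<theta> p)"
  shows "levi_form \<A> \<theta> p Z (\<Sum>j\<in>S. W j) = (\<Sum>j\<in>S. levi_form \<A> \<theta> p Z (W j))"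
proof -
  have "levi_form \<A> \<theta> p Z 0 = 0"
    using levi_form_add_right[OF assms, of Z 0 0] by simp
  then show ?thesis
    by (induction S rule: infinite_finite_induct) (auto simp: levi_form_add_right[OF assms])
qed

definition complex_combination ::
  "('n::finite \<Rightarrow> 'v::real_vector \<times> 'v) \<Rightarrow> complex ^ 'n \<Rightarrow> 'v \<times> 'v"
  where "complex_combination L v = (\<Sum>j\<in>UNIV. cscale (v $ j) (L j))"

lemma levi_form_complex_combination:
  assumes "bilinear (ext_deriv \<A> \<theta> p)"
  shows "levi_form \<A> \<theta> p (complex_combination (\<lambda>j. L_field J (X j) p) v)
      (complex_combination (\<lambda>j. L_field J (X j) p) w) = sesq_form (levi_matrix \<A> J \<theta> X p) v w"
  unfolding complex_combination_def sesq_form_def levi_matrix_def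
  by (subst levi_form_sum_left[OF assms])
    (simp add: levi_form_sum_right[OF assms] levi_form_scale_left[OF assms]
      levi_form_scale_right[OF assms] sum_distrib_left mult_ac)

lemma complex_combination_linear:
  "Vector_Spaces.linear (*s) cscale (complex_combination L)"
  by (unfold_locales)
    (simp_all add: complex_combination_def complexification.scale_left_distrib sum.distrib
      complexification.scale_sum_right complexification.scale_scale)

text \<open>The target may have infinite dimension: tangent spaces are subspaces of the space of all
  families of coordinate vectors, indexed by all charts. If a basis vector is mapped to 0, the
  images of the others already span the range, which is then too small.\<close>

lemma linear_inj_if_dim_range:
  fixes g :: "'e::euclidean_space \<Rightarrow> 'v::real_vector"
  assumes lin: "linear g" and dim: "DIM('e) \<le> dim (range g)"
  shows "inj g"
proof (rule ccontr)
  assume "\<not> inj g"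
  then obtain a where a: "g a = 0" "a \<noteq> 0"
    using linear_injective_0[OF lin] by blast
  obtain B where B: "{a} \<subseteq> B" "independent B" "UNIV \<subseteq> span B"
    using maximal_independent_subset_extend[of "{a}" UNIV] a(2) by auto
  have finB: "finite B"
    using B(2) by (rule finiteI_independent)
  have cardB: "card B = DIM('e)"
    using basis_card_eq_dim[of B UNIV] B by simp
  have "range g \<subseteq> span (g ` (B - {a}))"
  proof -
    have "g ` B \<subseteq> insert 0 (g ` (B - {a}))"
      using a by auto
    from span_mono[OF this] have "span (g ` B) \<subseteq> span (g ` (B - {a}))"
      by (simp add: span_insert_0)
    moreover have "span (g ` B) = range g"
      using span_linear_image[OF lin, of B] B(3) by auto
    ultimately show ?thesis
      by simp
  qed
  then have "dim (range g) \<le> card (g ` (B - {a}))"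
    using finB by (intro dim_le_card) auto
  also have "\<dots> \<le> card (B - {a})"
    using finB by (intro card_image_le) auto
  also have "\<dots> < card B"
    using B(1) finB by (intro psubset_card_mono) auto
  finally show False
    using dim cardB by simp
qed

text \<open>A complex vector of length \<open>n\<close> serves as the list of the \<open>2n\<close> real coordinates with respect
  to \<open>X\<^sub>1, \<dots>, X\<^sub>n, Y\<^sub>1, \<dots>, Y\<^sub>n\<close>; this is the real part of a complex combination of the vectors
  \<open>X\<^sub>j - \<i> Y\<^sub>j\<close>.\<close>

lemma real_frame_coordinates:
  fixes X Y :: "'n::finite \<Rightarrow> 'v::real_vector"
  assumes dim: "dim (span (range X \<union> range Y)) = 2 * CARD('n)"
  defines "g \<equiv> \<lambda>v :: complex ^ 'n. \<Sum>j\<in>UNIV. Re (v $ j) *\<^sub>R X j + Im (v $ j) *\<^sub>R Y j"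
  shows "inj g" and "range g = span (range X \<union> range Y)"
proof -
  have lin: "linear g"
    by (rule linearI) (simp_all add: g_def scaleR_add_left sum.distrib scaleR_sum_right
        scaleR_add_right algebra_simps)
  show range: "range g = span (range X \<union> range Y)"
  proof
    show "range g \<subseteq> span (range X \<union> range Y)"
      by (auto simp: g_def intro!: span_sum span_add span_scale intro: span_base)
    have "g (axis j 1) = X j" "g (axis j \<i>) = Y j" for j
      by (simp_all add: g_def axis_def if_distrib if_distribR cong: if_cong)
    then have "X j \<in> range g" "Y j \<in> range g" for j
      by (auto intro: range_eqI[OF sym])
    then have "range X \<union> range Y \<subseteq> range g"
      by blast
    then show "span (range X \<union> range Y) \<subseteq> range g"
      using linear_subspace_image[OF lin subspace_UNIV] by (rule span_minimal)
  qed
  show "inj g"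
    using dim by (intro linear_inj_if_dim_range[OF lin]) (simp add: range)
qed

lemma real_linear_on_neg:
  assumes "real_linear_on S f" "v \<in> S"
  shows "f (- v) = - f v"
proof -
  have "f ((- 1) *\<^sub>R v) = (- 1) *\<^sub>R f v"
    using assms unfolding real_linear_on_def by blast
  then show ?thesis
    by simp
qed

lemma H10_subspace:
  assumes lin: "real_linear_on (H p) (J p)" and H: "subspace (H p)"
  shows "complexification.subspace (H10 H J p)"
proof (rule complexification.subspaceI)
  have add: "J p (u + v) = J p u + J p v" and scale: "J p (r *\<^sub>R u) = r *\<^sub>R J p u"
    if "u \<in> H p" "v \<in> H p" for u v r
    using lin that unfolding real_linear_on_def by blast+
  have zero: "J p 0 = 0"
    using scale[of 0 0 0] subspace_0[OF H] by simp
  have diff: "J p (u - v) = J p u - J p v" if "u \<in> H p" "v \<in> H p" for u v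
    using add[of u "- v"] real_linear_on_neg[OF lin] that subspace_neg[OF H] by simp
  show "0 \<in> H10 H J p"
    using subspace_0[OF H] zero by (simp add: H10_def cscale_def zero_prod_def)
  show "Z + W \<in> H10 H J p" if "Z \<in> H10 H J p" "W \<in> H10 H J p" for Z W
    using that by (auto simp: H10_def cscale_def add subspace_add[OF H])
  show "cscale z Z \<in> H10 H J p" if "Z \<in> H10 H J p" for z Z
    using that by (auto simp: H10_def cscale_def add diff scale subspace_add[OF H]
        subspace_diff[OF H] subspace_scale[OF H])
qed

text \<open>The real part of an element \<open>Z\<close> of \<open>H\<^bsup>1,0\<^esup>\<close> is an arbitrary vector \<open>u\<close> of \<open>H\<close> and determines
  the imaginary part as \<open>- J u\<close>. So the statement reduces to the real coordinates of \<open>u\<close> in the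
  frame \<open>X\<^sub>j, JX\<^sub>j\<close>.\<close>

lemma complex_combination_H10:
  fixes X :: "'n::finite \<Rightarrow> 'a \<Rightarrow> ('a, 'm::finite) tvec"
  assumes lin: "real_linear_on (H p) (J p)"
    and J2: "\<forall>v\<in>H p. J p (J p v) = - v"
    and span: "span (range (\<lambda>j. X j p) \<union> range (\<lambda>j. J p (X j p))) = H p"
    and dim: "dim (H p) = 2 * CARD('n)"
  defines "L \<equiv> \<lambda>j. L_field J (X j) p"
  shows "inj (complex_combination L)" and "range (complex_combination L) = H10 H J p"
proof -
  let ?g = "\<lambda>v :: complex ^ 'n. \<Sum>j\<in>UNIV. Re (v $ j) *\<^sub>R X j p + Im (v $ j) *\<^sub>R J p (X j p)"
  have g: "inj ?g" "range ?g = H p"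
    using real_frame_coordinates[of "\<lambda>j. X j p" "\<lambda>j. J p (X j p)"] dim span by auto
  have fst_comb: "fst (complex_combination L v) = ?g v" for v
    by (simp add: complex_combination_def L_def L_field_def cscale_def fst_sum)
  show "inj (complex_combination L)"
  proof (rule injI)
    fix v w assume "complex_combination L v = complex_combination L w"
    then have "?g v = ?g w"
      by (simp flip: fst_comb)
    then show "v = w"
      using g(1) by (rule injD[rotated])
  qed
  have H: "subspace (H p)"
    using span subspace_span by metis
  have "L j \<in> H10 H J p" for j
  proof -
    have "X j p \<in> H p" "J p (X j p) \<in> H p"
      unfolding span[symmetric] by (auto intro: span_base)
    then show ?thesis
      using J2 subspace_neg[OF H] real_linear_on_neg[OF lin]
      by (simp add: L_def L_field_def H10_def cscale_def)
  qed
  then have sub: "complex_combination L v \<in> H10 H J p" for v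
    using H10_subspace[where H = H and J = J and p = p, OF lin H] unfolding complex_combination_def
    by (intro complexification.subspace_sum complexification.subspace_scale) auto
  have determined: "snd Z = - J p (fst Z)" if "Z \<in> H10 H J p" for Z
    using that by (auto simp: H10_def cscale_def)
  show "range (complex_combination L) = H10 H J p"
  proof
    show "range (complex_combination L) \<subseteq> H10 H J p"
      using sub by blast
    show "H10 H J p \<subseteq> range (complex_combination L)"
    proof
      fix Z assume Z: "Z \<in> H10 H J p"
      then have "fst Z \<in> range ?g"
        unfolding g(2) by (auto simp: H10_def)
      then obtain v where "fst Z = ?g v"
        by blast
      then have "fst Z = fst (complex_combination L v)"
        using fst_comb by simp
      then have "Z = complex_combination L v"
        using determined[OF Z] determined[OF sub] by (simp add: prod_eq_iff)
      then show "Z \<in> range (complex_combination L)"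
        by blast
    qed
  qed
qed


text \<open>The coordinate map of the frame is an isomorphism onto \<open>H\<^bsup>1,0\<^esup>\<close>, under which the null space
  corresponds to the left kernel.\<close>

lemma dim_levi_null_space:
  fixes X :: "'n::finite \<Rightarrow> 'a \<Rightarrow> ('a, 'm::finite) tvec"
  assumes bil: "bilinear (ext_deriv \<A> \<theta> p)"
    and lin: "real_linear_on (H p) (J p)"
    and J2: "\<forall>v\<in>H p. J p (J p v) = - v"
    and span: "span (range (\<lambda>j. X j p) \<union> range (\<lambda>j. J p (X j p))) = H p"
    and dim: "dim (H p) = 2 * CARD('n)"
    and psd: "pos_semidefinite (levi_matrix \<A> J \<theta> X p)"
  shows "complexification.dim (levi_null_space \<A> H J \<theta> p) =
    vec.dim {v. v v* levi_matrix \<A> J \<theta> X p = 0}"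
proof -
  let ?\<phi> = "complex_combination (\<lambda>j. L_field J (X j) p)"
  let ?T = "levi_matrix \<A> J \<theta> X p"
  note \<phi> = complex_combination_H10[where H = H and J = J and X = X and p = p, OF lin J2 span dim]
  have "levi_null_space \<A> H J \<theta> p = {Z \<in> range ?\<phi>. levi_form \<A> \<theta> p Z Z = 0}"
    unfolding levi_null_space_def \<phi>(2) ..
  also have "\<dots> = ?\<phi> ` {v. levi_form \<A> \<theta> p (?\<phi> v) (?\<phi> v) = 0}"
    by blast
  also have "\<dots> = ?\<phi> ` {v. v v* ?T = 0}"
    unfolding levi_form_complex_combination[OF bil] sesq_form_null_iff_left_kernel[OF psd] ..
  finally have null: "levi_null_space \<A> H J \<theta> p = ?\<phi> ` {v. v v* ?T = 0}" .
  have "finite_dimensional_vector_space_pair_1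
      ((*s) :: complex \<Rightarrow> complex ^ 'n \<Rightarrow> complex ^ 'n) cart_basis
      (cscale :: complex \<Rightarrow> ('a, 'm) tvec \<times> ('a, 'm) tvec \<Rightarrow> _)"
    ..
  then show ?thesis
    unfolding null
    by (rule finite_dimensional_vector_space_pair_1.dim_image_eq
        [OF _ complex_combination_linear inj_on_subset[OF \<phi>(1) subset_UNIV]])
qed

lemma smooth_subbundle_dim:
  assumes "smooth_subbundle \<A> r H"
  shows "dim (H p) = r"
proof -
  have "\<exists>V E. open V \<and> p \<in> V \<and> (\<forall>i<r. smooth_vector_field \<A> V (E i)) \<and>
      (\<forall>x\<in>V. H x = span {E i x | i. i < r} \<and> dim (H x) = r)"
    using assms unfolding smooth_subbundle_def by (rule spec)
  then obtain V E where "p \<in> V" and V: "\<forall>x\<in>V. H x = span {E i x | i. i < r} \<and> dim (H x) = r"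
    by (elim exE conjE) (rule that)
  show ?thesis
    using bspec[OF V \<open>p \<in> V\<close>] by (rule conjunct2)
qed

section \<open>The sets of given nullity\<close>

theorem theorem2p1:
  fixes \<A> :: "('a::{t2_space, second_countable_topology}, 'm::finite) chart set"
    and H :: "'a \<Rightarrow> ('a, 'm) tvec set"
    and J :: "'a \<Rightarrow> ('a, 'm) tvec \<Rightarrow> ('a, 'm) tvec"
    and U :: "'a set"
    and \<theta> :: "'a \<Rightarrow> ('a, 'm) tvec \<Rightarrow> real"
    and X :: "'n::finite \<Rightarrow> 'a \<Rightarrow> ('a, 'm) tvec"
    and A :: "nat \<Rightarrow> 'a \<Rightarrow> complex"
    and q :: nat
  assumes "connected (UNIV :: 'a set)"
    and "oriented_atlas \<A>"
    and "CARD('m) = 2 * CARD('n) + 1"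
    and "cr_structure \<A> H J"
    and "pseudoconvex \<A> H J"
    and "open U"
    and "defining_form \<A> H U \<theta>"
    and "\<And>j. smooth_vector_field \<A> U (X j)"
    and "\<And>p. p \<in> U \<Longrightarrow> span (range (\<lambda>j. X j p) \<union> range (\<lambda>j. J p (X j p))) = H p"
    and "\<And>p. p \<in> U \<Longrightarrow> pos_semidefinite (levi_matrix \<A> J \<theta> X p)"
    and "\<And>p \<mu>. p \<in> U \<Longrightarrow>
           det (levi_matrix \<A> J \<theta> X p - mat \<mu>) =
             (\<Sum>k = 0..CARD('n) - 1. A k p * (- \<mu>) ^ k) + (- \<mu>) ^ CARD('n)"
    and "1 \<le> q" and "q \<le> CARD('n)"
  shows "nullity_ge_set \<A> H J q \<inter> U = {x \<in> U. \<forall>j. 0 \<le> j \<and> j \<le> q - 1 \<longrightarrow> A j x = 0}"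
proof -
  have atlas: "smooth_atlas \<A>"
    using assms(2) by (simp add: oriented_atlas_def)
  have "p \<in> nullity_ge_set \<A> H J q \<longleftrightarrow> (\<forall>j<q. A j p = 0)" if p: "p \<in> U" for p
  proof -
    let ?T = "levi_matrix \<A> J \<theta> X p"
    have bil: "bilinear (ext_deriv \<A> \<theta> p)"
      using assms(6,7) p by (intro ext_deriv_bilinear[OF atlas]) (auto simp: defining_form_def)
    have lin: "real_linear_on (H p) (J p)" and J2: "\<forall>v\<in>H p. J p (J p v) = - v"
      using assms(4) by (auto simp: cr_structure_def)
    have "smooth_subbundle \<A> (CARD('m) - 1) H"
      using assms(4) by (simp add: cr_structure_def)
    then have "dim (H p) = CARD('m) - 1"
      by (rule smooth_subbundle_dim)
    then have dim: "dim (H p) = 2 * CARD('n)"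
      using assms(3) by simp
    have same_null: "levi_null_space \<A> H J \<theta>' p = levi_null_space \<A> H J \<theta> p"
      if "open V" "p \<in> V" "defining_form \<A> H V \<theta>'" for V \<theta>'
      using atlas assms(6) p assms(7) that by (rule levi_null_space_indep)
    have "p \<in> nullity_ge_set \<A> H J q \<longleftrightarrow>
        q \<le> complexification.dim (levi_null_space \<A> H J \<theta> p)" (is "_ \<longleftrightarrow> ?large")
    proof
      assume "p \<in> nullity_ge_set \<A> H J q"
      then obtain V \<theta>' where V: "open V" "p \<in> V" "defining_form \<A> H V \<theta>'"
        and large: "q \<le> complexification.dim (levi_null_space \<A> H J \<theta>' p)"
        unfolding nullity_ge_set_def mem_Collect_eq by (elim exE conjE) (rule that)
      show ?large
        using large unfolding same_null[OF V] .
    next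
      assume ?large
      then show "p \<in> nullity_ge_set \<A> H J q"
        unfolding nullity_ge_set_def mem_Collect_eq
        using assms(6,7) p by (intro exI conjI)
    qed
    also have "\<dots> \<longleftrightarrow> q \<le> vec.dim {v. v v* ?T = 0}"
      using dim_levi_null_space[where H = H and J = J and X = X and p = p,
          OF bil lin J2 assms(9)[OF p] dim assms(10)[OF p]] by simp
    also have "\<dots> \<longleftrightarrow> (\<forall>j<q. A j p = 0)"
      using assms(10)[OF p] assms(11)[OF p] assms(13) by (rule psd_kernel_dim_ge_iff)
    finally show ?thesis .
  qed
  moreover have "j \<le> q - 1 \<longleftrightarrow> j < q" for j
    using assms(12) by auto
  ultimately show ?thesis
    by auto
qed

end
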